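(* Let $T$ be a random vector with values in $\mathcal{T}\subseteq\mathbb{R}^d$, let $0<\alpha\le\beta$, and let $U:\mathcal{T}\times\mathbb{R}^r\to\mathbb{R}$ be a utility, twice differentiable in its second argument, with oracle action $\phi^*:\mathcal{T}\to\mathbb{R}^r$, such that for every $t\in\mathcal{T}$: (A0) $\phi^*(t)$ is an unconstrained maximizer of $a\mapsto U(t,a)$ on $\mathbb{R}^r$ (hence $\nabla_a U(t,\phi^*(t))=0$); (A1) $\nabla^2_{aa}U(t,a)\succeq-\beta I$ for all $a\in\mathbb{R}^r$; (A2) $\nabla^2_{aa}U(t,a)\preceq-\alpha I$ for all $a\in\mathbb{R}^r$. Let $R_{\mathrm{task}}$ be the task-oriented rate--distortion function of $T$ for the task loss $\ell(t,a)=U(t,\phi^*(t))-U(t,a)$, and let $R^{\phi^*}_{\mathrm{MSE}}$ be the mean-squared-error rate--distortion function of the source $\phi^*(T)$. Then for every $D\ge 0$, $$R^{\phi^*}_{\mathrm{MSE}}\!\left(\frac{2D}{\alpha}\right)\;\le\;R_{\mathrm{task}}(D)\;\le\;R^{\phi^*}_{\mathrm{MSE}}\!\left(\frac{2D}{\beta}\right).$$ Moreover, if $U(t,a)=u(t)-\frac{\gamma}{2}\|a-\phi^*(t)\|^2$ for some function $u:\mathcal{T}\to\mathbb{R}$ and some $\gamma>0$, then $R_{\mathrm{task}}(D)=R^{\phi^*}_{\mathrm{MSE}}(2D/\gamma)$.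
   Context: $\|\cdot\|$ is the Euclidean norm, $I$ the $r\times r$ identity, $\succeq,\preceq$ the Loewner order, and $\nabla_a,\nabla^2_{aa}$ the gradient and Hessian in the action variable $a$. $U$ and $\phi^*$ are assumed measurable. Rate--distortion functions ($I(\cdot;\cdot)$ is mutual information, $\inf\emptyset=+\infty$): $$R_{\mathrm{task}}(D)=\inf\{\,I(T;\hat A): p(\hat a\mid t)\text{ a conditional law (Markov kernel) from }\mathcal{T}\text{ to }\mathbb{R}^r\text{ with }\mathbb{E}[\ell(T,\hat A)]\le D\,\},$$ where $\hat A$ is the reproduction action produced by the kernel from $T$; and, with $X=\phi^*(T)$, $$R^{\phi^*}_{\mathrm{MSE}}(\delta)=\inf\{\,I(X;\hat A): p(\hat a\mid x)\text{ a Markov kernel from }\mathbb{R}^r\text{ to }\mathbb{R}^r\text{ with }\mathbb{E}\|X-\hat A\|^2\le\delta\,\}.$$ *)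

theory Defs
  imports "HOL-Probability.Probability"
begin

definition grad :: "('a::real_inner \<Rightarrow> real) \<Rightarrow> 'a \<Rightarrow> 'a" where
  "grad f x = (THE g. GDERIV f x :> g)"

definition hessian :: "(real ^ 'n \<Rightarrow> real) \<Rightarrow> real ^ 'n \<Rightarrow> real ^ 'n ^ 'n" where
  "hessian f x = matrix (frechet_derivative (grad f) (at x))"

definition twice_differentiable :: "(real ^ 'n \<Rightarrow> real) \<Rightarrow> bool" where
  "twice_differentiable f \<longleftrightarrow>
     (\<forall>x. f differentiable (at x)) \<and> (\<forall>x. grad f differentiable (at x))"

text \<open>The Loewner order is only meant for symmetric matrices. The Hessian of a twice
  (Frechet) differentiable function is symmetric, so symmetry is not demanded here.\<close>

definition loewner_le :: "real ^ 'n ^ 'n \<Rightarrow> real ^ 'n ^ 'n \<Rightarrow> bool" (infix "\<preceq>\<^sub>L" 50) where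
  "A \<preceq>\<^sub>L B \<longleftrightarrow> (\<forall>v. 0 \<le> v \<bullet> ((B - A) *v v))"

text \<open>\<^const>\<open>KL_divergence\<close> is a Bochner integral, hence a junk real number when \<open>N\<close> is not
  absolutely continuous with respect to \<open>M\<close> or when the log-density is not \<open>N\<close>-integrable.
  For probability measures with \<open>N\<close> absolutely continuous, the negative part of the
  log-density is always \<open>N\<close>-integrable, so that non-integrability means that the divergence
  is \<open>\<infinity>\<close>.\<close>

definition extended_KL_divergence :: "real \<Rightarrow> 'a measure \<Rightarrow> 'a measure \<Rightarrow> ereal" where
  "extended_KL_divergence b M N =
     (if absolutely_continuous M N \<and> integrable N (entropy_density b M N)
      then ereal (KL_divergence b M N) else \<infinity>)"

text \<open>The same formula as \<^const>\<open>prob_space.mutual_information\<close>, with values in \<open>[0, \<infinity>]\<close>.\<close>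

definition extended_mutual_information ::
    "real \<Rightarrow> 'w measure \<Rightarrow> 'a measure \<Rightarrow> 'b measure \<Rightarrow> ('w \<Rightarrow> 'a) \<Rightarrow> ('w \<Rightarrow> 'b) \<Rightarrow> ereal" where
  "extended_mutual_information b M S T X Y =
     extended_KL_divergence b (distr M S X \<Otimes>\<^sub>M distr M T Y)
       (distr M (S \<Otimes>\<^sub>M T) (\<lambda>\<omega>. (X \<omega>, Y \<omega>)))"

text \<open>Joint law of source and reproduction, \<open>P(dx) K(x, da)\<close>.\<close>

definition joint_law :: "'a measure \<Rightarrow> ('a \<Rightarrow> 'b measure) \<Rightarrow> ('a \<times> 'b::topological_space) measure" where
  "joint_law P K =
     P \<bind> (\<lambda>x. K x \<bind> (\<lambda>a. return (P \<Otimes>\<^sub>M borel) (x, a)))"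

text \<open>\<open>P\<close> is the law of the source, \<open>d\<close> the distortion and \<open>b\<close> the base of the logarithm. A Markov
  kernel is a measurable map into \<^term>\<open>prob_algebra borel\<close>. The distortions used below are
  nonnegative; there ``integrable with integral at most \<open>D\<close>'' says exactly that the
  expected distortion, as an element of \<open>[0, \<infinity>]\<close>, is at most \<open>D\<close>. The infimum is that of
  \<^typ>\<open>ereal\<close>, so it is \<open>\<infinity>\<close> on the empty set.\<close>

definition rate_distortion ::
    "real \<Rightarrow> 'a measure \<Rightarrow> ('a \<Rightarrow> 'b::topological_space \<Rightarrow> real) \<Rightarrow> real \<Rightarrow> ereal" where
  "rate_distortion b P d D =
     Inf {extended_mutual_information b (joint_law P K) P borel fst snd | K.
            K \<in> P \<rightarrow>\<^sub>M prob_algebra borel \<and>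
            integrable (joint_law P K) (\<lambda>(x, a). d x a) \<and>
            (\<integral>(x, a). d x a \<partial>joint_law P K) \<le> D}"

definition task_loss :: "('t \<Rightarrow> 'a \<Rightarrow> real) \<Rightarrow> ('t \<Rightarrow> 'a) \<Rightarrow> 't \<Rightarrow> 'a \<Rightarrow> real" where
  "task_loss U \<phi> t a = U t (\<phi> t) - U t a"

text \<open>\<open>S\<close> is the set of values of the random vector \<open>T\<close>; it carries the trace Borel algebra.\<close>

definition R_task ::
    "real \<Rightarrow> 'w measure \<Rightarrow> ('w \<Rightarrow> 't::topological_space) \<Rightarrow> 't set \<Rightarrow>
     ('t \<Rightarrow> 'a::topological_space \<Rightarrow> real) \<Rightarrow> ('t \<Rightarrow> 'a) \<Rightarrow> real \<Rightarrow> ereal" where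
  "R_task b M T S U \<phi> D =
     rate_distortion b (distr M (restrict_space borel S) T) (task_loss U \<phi>) D"

definition R_MSE ::
    "real \<Rightarrow> 'w measure \<Rightarrow> ('w \<Rightarrow> 'a::real_normed_vector) \<Rightarrow> real \<Rightarrow> ereal" where
  "R_MSE b M X \<delta> = rate_distortion b (distr M borel X) (\<lambda>x a. (norm (x - a))\<^sup>2) \<delta>"

end

theory Submission
  imports Defs
begin

text \<open>A second-order expansion of \<open>U t\<close> at its maximizer \<open>\<phi> t\<close> puts the task loss between
  \<open>\<alpha>/2 \<parallel>a - \<phi> t\<parallel>\<^sup>2\<close> and \<open>\<beta>/2 \<parallel>a - \<phi> t\<parallel>\<^sup>2\<close>, so it remains to compare coding
  \<open>T\<close> with coding \<open>X = \<phi> T\<close>. A kernel \<open>K\<close> for \<open>X\<close> gives the kernel \<open>K \<circ> \<phi>\<close> for \<open>T\<close>, with the same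
  mutual information, because the density of the joint law of \<open>T\<close> and the reproduction is that of
  the joint law of \<open>X\<close> and the reproduction, composed with \<open>\<phi>\<close>. Conversely, a kernel for \<open>T\<close> of finite
  mutual information induces a joint law of \<open>X\<close> and the reproduction that comes from a kernel for
  \<open>X\<close> and, by data processing, has no larger mutual information.\<close>

section \<open>Second-order bounds\<close>

text \<open>\<open>grad\<close> is a definite description, so it carries meaning only once a
  gradient exists and is unique. In finite dimension the derivative is a linear functional,
  represented by the vector \<open>adjoint f' 1\<close>; two representing vectors coincide, as
  testing on their difference shows.\<close>

lemma GDERIV_grad:
  fixes f :: "'a::euclidean_space \<Rightarrow> real"
  assumes "f differentiable (at x)"
  shows "GDERIV f x :> grad f x"
proof -
  obtain f' where f': "(f has_derivative f') (at x)"
    using assms by (auto simp: differentiable_def)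
  have "f' = (\<lambda>h. h \<bullet> adjoint f' 1)"
    using adjoint_works[OF has_derivative_linear[OF f']] by (simp add: fun_eq_iff)
  then have ex: "GDERIV f x :> adjoint f' 1"
    using f' by (simp add: gderiv_def)
  have "g = adjoint f' 1" if "GDERIV f x :> g" for g
  proof -
    have "(\<lambda>h. h \<bullet> g) = (\<lambda>h. h \<bullet> adjoint f' 1)"
      using ex that by (auto simp: gderiv_def intro: has_derivative_unique)
    then have "(g - adjoint f' 1) \<bullet> g = (g - adjoint f' 1) \<bullet> adjoint f' 1"
      by (rule fun_cong)
    then have "(g - adjoint f' 1) \<bullet> (g - adjoint f' 1) = 0"
      by (simp only: inner_diff_right diff_self)
    then show ?thesis
      by simp
  qed
  with ex have "\<exists>!g. GDERIV f x :> g"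
    by blast
  then show ?thesis
    unfolding grad_def by (rule theI')
qed

text \<open>Along the line \<open>s \<mapsto> x + s *\<^sub>R v\<close> this is a one-dimensional
  expansion. The Lagrange form of the remainder asks only for existence of the second derivative,
  which is what \<open>twice_differentiable\<close> provides. That \<open>c\<close> lies on the
  segment is not recorded, since the Hessian bounds to be applied hold at every point.\<close>

lemma twice_differentiable_Taylor:
  fixes f :: "real ^ 'n \<Rightarrow> real"
  assumes "twice_differentiable f"
  shows "\<exists>c. f (x + v) = f x + v \<bullet> grad f x + v \<bullet> (hessian f c *v v) / 2"
proof -
  define p where "p s = x + s *\<^sub>R v" for s :: real
  have p: "(p has_derivative (\<lambda>h. h *\<^sub>R v)) (at s)" for s
    unfolding p_def by (auto intro!: derivative_eq_intros)
  have "(f has_derivative (\<lambda>h. h \<bullet> grad f y)) (at y)" for y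
    using assms GDERIV_grad by (auto simp: twice_differentiable_def gderiv_def)
  from has_derivative_compose[OF p this]
  have d1: "((\<lambda>s. f (p s)) has_real_derivative v \<bullet> grad f (p s)) (at s)" for s
    by (simp add: has_field_derivative_def mult_commute_abs)
  have gd: "(grad f has_derivative frechet_derivative (grad f) (at y)) (at y)" for y
    using assms by (simp add: twice_differentiable_def frechet_derivative_works)
  have hess: "hessian f y *v w = frechet_derivative (grad f) (at y) w" for y w
    unfolding hessian_def
    by (rule matrix_works) (use has_derivative_linear[OF gd] in \<open>simp add: linear_matrix_vector_mul_eq\<close>)
  have d2: "((\<lambda>s. v \<bullet> grad f (p s)) has_real_derivative v \<bullet> (hessian f (p s) *v v)) (at s)" for s
  proof -
    have "((\<lambda>s. v \<bullet> grad f (p s)) has_derivative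
        (\<lambda>h. v \<bullet> frechet_derivative (grad f) (at (p s)) (h *\<^sub>R v))) (at s)"
      by (rule has_derivative_inner_right[OF has_derivative_compose[OF p gd]])
    moreover have "(\<lambda>h. v \<bullet> frechet_derivative (grad f) (at (p s)) (h *\<^sub>R v))
        = (*) (v \<bullet> (hessian f (p s) *v v))"
      by (simp add: fun_eq_iff hess linear_scale[OF has_derivative_linear[OF gd]])
    ultimately show ?thesis
      by (simp add: has_field_derivative_def)
  qed
  \<comment> \<open>The sequence of successive derivatives that \<open>Maclaurin\<close> takes as
    argument; the expansion stops at order two, so the values for \<open>m > 2\<close> are
    arbitrary.\<close>
  define diff where
    "diff m = (if m = 0 then (\<lambda>s. f (p s)) else if m = 1 then (\<lambda>s. v \<bullet> grad f (p s))
       else (\<lambda>s. v \<bullet> (hessian f (p s) *v v)))" for m :: nat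
  have "\<forall>m t. m < 2 \<and> 0 \<le> t \<and> t \<le> 1 \<longrightarrow> DERIV (diff m) t :> diff (Suc m) t"
    using d1 d2 by (auto simp: diff_def less_2_cases_iff)
  moreover have "diff 0 = (\<lambda>s. f (p s))"
    by (simp add: diff_def)
  ultimately obtain t where
    "f (p 1) = (\<Sum>m<2. diff m 0 / fact m * 1 ^ m) + diff 2 t / fact 2 * 1 ^ 2"
    using Maclaurin[OF zero_less_one pos2, of diff "\<lambda>s. f (p s)"] by blast
  moreover have "{..<2::nat} = {0, 1}"
    by auto
  ultimately have "f (x + v) = f x + v \<bullet> grad f x + v \<bullet> (hessian f (p t) *v v) / 2"
    by (simp add: diff_def p_def)
  then show ?thesis
    by blast
qed

text \<open>The gradient vanishes at the unconstrained maximizer \<open>x\<close>, so the expansion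
  there consists of the quadratic term alone. Its Hessian sits at an unknown point, hence the need
  for bounds uniform in \<open>a\<close>.\<close>

lemma suboptimality_bounds:
  fixes f :: "real ^ 'n \<Rightarrow> real"
  assumes f: "twice_differentiable f"
    and max: "\<And>a. f a \<le> f x"
    and lo: "\<And>a. (- \<beta>) *\<^sub>R mat 1 \<preceq>\<^sub>L hessian f a"
    and up: "\<And>a. hessian f a \<preceq>\<^sub>L (- \<alpha>) *\<^sub>R mat 1"
  shows "\<alpha> / 2 * (norm (x - a))\<^sup>2 \<le> f x - f a" "f x - f a \<le> \<beta> / 2 * (norm (x - a))\<^sup>2"
proof -
  have "GDERIV f x :> grad f x"
    using f by (intro GDERIV_grad) (simp add: twice_differentiable_def)
  then have "(\<lambda>h. h \<bullet> grad f x) = (\<lambda>h. 0)"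
    using max by (intro differential_zero_maxmin[of x UNIV f]) (auto simp: gderiv_def)
  then have grad: "(a - x) \<bullet> grad f x = 0"
    by (rule fun_cong)
  define v where "v = a - x"
  obtain c where "f (x + v) = f x + v \<bullet> grad f x + v \<bullet> (hessian f c *v v) / 2"
    using twice_differentiable_Taylor[OF f] by blast
  then have c: "f a = f x + v \<bullet> (hessian f c *v v) / 2"
    using grad by (simp add: v_def)
  have sq: "v \<bullet> v = (norm (x - a))\<^sup>2"
    by (simp add: v_def dot_square_norm norm_minus_commute)
  have scal: "(k *\<^sub>R mat 1) *v v = k *\<^sub>R v" for k and v :: "real ^ 'n"
    by (simp add: scaleR_matrix_vector_assoc[symmetric])
  have "0 \<le> v \<bullet> ((hessian f c - (- \<beta>) *\<^sub>R mat 1) *v v)"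
    "0 \<le> v \<bullet> (((- \<alpha>) *\<^sub>R mat 1 - hessian f c) *v v)"
    using lo[of c] up[of c] unfolding loewner_le_def by blast+
  then have "- \<beta> * (norm (x - a))\<^sup>2 \<le> v \<bullet> (hessian f c *v v)"
    "v \<bullet> (hessian f c *v v) \<le> - \<alpha> * (norm (x - a))\<^sup>2"
    by (simp_all only: matrix_vector_mult_diff_rdistrib inner_diff_right scal inner_scaleR_right sq)
  with c show "\<alpha> / 2 * (norm (x - a))\<^sup>2 \<le> f x - f a"
    "f x - f a \<le> \<beta> / 2 * (norm (x - a))\<^sup>2"
    by simp_all
qed

section \<open>Joint laws\<close>

text \<open>Measurable rectangles are an intersection-stable generator of the product algebra, and
  the whole space is itself a rectangle of finite measure, so a constant sequence exhausts it. Joint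
  laws are identified below through this criterion.\<close>

lemma measure_eqI_rectangles:
  assumes sets: "sets J = sets (M \<Otimes>\<^sub>M N)" "sets J' = sets (M \<Otimes>\<^sub>M N)"
    and "finite_measure J"
    and eq: "\<And>A B. A \<in> sets M \<Longrightarrow> B \<in> sets N \<Longrightarrow> emeasure J (A \<times> B) = emeasure J' (A \<times> B)"
  shows "J = J'"
proof (rule measure_eqI_generator_eq[OF Int_stable_pair_measure_generator[of M N],
      where A = "\<lambda>_. space M \<times> space N" and \<Omega> = "space M \<times> space N"])
  interpret finite_measure J by fact
  show "{a \<times> b |a b. a \<in> sets M \<and> b \<in> sets N} \<subseteq> Pow (space M \<times> space N)"
    by (rule pair_measure_closed)
  show "emeasure J (space M \<times> space N) \<noteq> \<infinity>"
    by simp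
qed (use sets eq in \<open>auto simp: sets_pair_measure\<close>)

context
  fixes P :: "'a measure" and K :: "'a \<Rightarrow> 'b::topological_space measure"
  assumes P: "prob_space P" and K: "K \<in> P \<rightarrow>\<^sub>M prob_algebra borel"
begin

interpretation P: prob_space P by (rule P)

lemma measurable_joint_kernel:
  "(\<lambda>x. K x \<bind> (\<lambda>a. return (P \<Otimes>\<^sub>M borel) (x, a))) \<in> P \<rightarrow>\<^sub>M prob_algebra (P \<Otimes>\<^sub>M borel)"
  by (rule measurable_bind_prob_space2[OF K]) measurable

lemma sets_joint_law: "sets (joint_law P K) = sets (P \<Otimes>\<^sub>M borel)"
  unfolding joint_law_def
  by (rule sets_bind_measurable[OF measurable_prob_algebraD[OF measurable_joint_kernel] P.not_empty])

lemma prob_space_joint_law: "prob_space (joint_law P K)"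
  unfolding joint_law_def
  using measurable_joint_kernel
  by (intro P.prob_space_bind AE_I2 measurable_prob_algebraD) (auto dest: measurable_space simp: space_prob_algebra)

lemma sets_kernel_borel: "x \<in> space P \<Longrightarrow> sets (K x) = sets borel"
  using measurable_space[OF K] by (simp add: space_prob_algebra)

lemma prob_space_kernel_borel: "x \<in> space P \<Longrightarrow> prob_space (K x)"
  using measurable_space[OF K] by (simp add: space_prob_algebra)

lemma nn_integral_joint_law:
  assumes g: "g \<in> borel_measurable (P \<Otimes>\<^sub>M borel)"
  shows "(\<integral>\<^sup>+z. g z \<partial>joint_law P K) = (\<integral>\<^sup>+x. \<integral>\<^sup>+a. g (x, a) \<partial>K x \<partial>P)"
proof -
  have "(\<integral>\<^sup>+z. g z \<partial>joint_law P K)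
      = (\<integral>\<^sup>+x. \<integral>\<^sup>+z. g z \<partial>(K x \<bind> (\<lambda>a. return (P \<Otimes>\<^sub>M borel) (x, a))) \<partial>P)"
    unfolding joint_law_def
    by (rule nn_integral_bind[OF g measurable_prob_algebraD[OF measurable_joint_kernel]])
  also have "\<dots> = (\<integral>\<^sup>+x. \<integral>\<^sup>+a. g (x, a) \<partial>K x \<partial>P)"
  proof (rule nn_integral_cong)
    fix x assume x: "x \<in> space P"
    note [measurable_cong] = sets_kernel_borel[OF x]
    have "(\<lambda>a. return (P \<Otimes>\<^sub>M borel) (x, a)) \<in> K x \<rightarrow>\<^sub>M subprob_algebra (P \<Otimes>\<^sub>M borel)"
      using x by (intro measurable_compose[OF _ return_measurable]) measurable
    from nn_integral_bind[OF g this]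
    have "(\<integral>\<^sup>+z. g z \<partial>(K x \<bind> (\<lambda>a. return (P \<Otimes>\<^sub>M borel) (x, a))))
        = (\<integral>\<^sup>+a. \<integral>\<^sup>+z. g z \<partial>return (P \<Otimes>\<^sub>M borel) (x, a) \<partial>K x)" .
    also have "\<dots> = (\<integral>\<^sup>+a. g (x, a) \<partial>K x)"
      using x sets_eq_imp_space_eq[OF sets_kernel_borel[OF x]]
      by (intro nn_integral_cong nn_integral_return g) (auto simp: space_pair_measure)
    finally show "(\<integral>\<^sup>+z. g z \<partial>(K x \<bind> (\<lambda>a. return (P \<Otimes>\<^sub>M borel) (x, a))))
        = (\<integral>\<^sup>+a. g (x, a) \<partial>K x)" .
  qed
  finally show ?thesis .
qed

lemma emeasure_joint_law_Times:
  assumes "A \<in> sets P" "B \<in> sets borel"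
  shows "emeasure (joint_law P K) (A \<times> B) = (\<integral>\<^sup>+x. indicator A x * emeasure (K x) B \<partial>P)"
proof -
  have AB: "A \<times> B \<in> sets (P \<Otimes>\<^sub>M borel)"
    using assms by simp
  have "emeasure (joint_law P K) (A \<times> B) = (\<integral>\<^sup>+z. indicator (A \<times> B) z \<partial>joint_law P K)"
    using AB by (simp add: sets_joint_law)
  also have "\<dots> = (\<integral>\<^sup>+x. \<integral>\<^sup>+a. indicator A x * indicator B a \<partial>K x \<partial>P)"
    using AB by (subst nn_integral_joint_law) (simp_all add: indicator_times)
  also have "\<dots> = (\<integral>\<^sup>+x. indicator A x * emeasure (K x) B \<partial>P)"
  proof (rule nn_integral_cong)
    fix x assume x: "x \<in> space P"
    note [measurable_cong] = sets_kernel_borel[OF x]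
    have "indicator B \<in> borel_measurable (K x)"
      using assms by measurable
    then show "(\<integral>\<^sup>+a. indicator A x * indicator B a \<partial>K x) = indicator A x * emeasure (K x) B"
      using assms x by (simp add: nn_integral_cmult sets_kernel_borel)
  qed
  finally show ?thesis .
qed

lemma distr_fst_joint_law: "distr (joint_law P K) P fst = P"
proof (rule measure_eqI)
  fix A assume "A \<in> sets (distr (joint_law P K) P fst)"
  then have A: "A \<in> sets P"
    by simp
  have "fst -` A \<inter> space (joint_law P K) = A \<times> (UNIV :: 'b set)"
    using sets.sets_into_space[OF A] sets_eq_imp_space_eq[OF sets_joint_law]
    by (auto simp: space_pair_measure)
  moreover have "fst \<in> joint_law P K \<rightarrow>\<^sub>M P"
    by (simp add: measurable_cong_sets[OF sets_joint_law refl])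
  ultimately have "emeasure (distr (joint_law P K) P fst) A
      = (\<integral>\<^sup>+x. indicator A x * emeasure (K x) UNIV \<partial>P)"
    using A by (simp add: emeasure_distr emeasure_joint_law_Times)
  also have "\<dots> = (\<integral>\<^sup>+x. indicator A x \<partial>P)"
    using prob_space.emeasure_space_1[OF prob_space_kernel_borel]
      sets_eq_imp_space_eq[OF sets_kernel_borel]
    by (intro nn_integral_cong) (simp flip: space_borel)
  finally show "emeasure (distr (joint_law P K) P fst) A = emeasure P A"
    using A by simp
qed simp

text \<open>The source marginal of a joint law is \<open>P\<close> again and the pairing of
  \<open>fst\<close> and \<open>snd\<close> is the identity. All later estimates of the rate work
  with this divergence.\<close>

lemma mutual_information_joint_law:
  "extended_mutual_information b (joint_law P K) P borel fst snd
    = extended_KL_divergence b (P \<Otimes>\<^sub>M distr (joint_law P K) borel snd) (joint_law P K)"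
proof -
  have "distr (joint_law P K) (P \<Otimes>\<^sub>M borel) (\<lambda>\<omega>. (fst \<omega>, snd \<omega>)) = joint_law P K"
    by (simp add: distr_id2 sets_joint_law)
  then show ?thesis
    by (simp add: extended_mutual_information_def distr_fst_joint_law)
qed

end

text \<open>Change of variables: on \<open>A \<times> B\<close> both sides have mass equal to the
  integral of \<open>indicator A (\<phi> t) * emeasure (K (\<phi> t)) B\<close> over
  \<open>P\<close>. Thus coding the source through \<open>\<phi>\<close> and coding its image give
  the same law of image and reproduction.\<close>

lemma joint_law_distr:
  assumes P: "prob_space P" and \<phi>: "\<phi> \<in> P \<rightarrow>\<^sub>M N" and K: "K \<in> N \<rightarrow>\<^sub>M prob_algebra borel"
  shows "distr (joint_law P (\<lambda>t. K (\<phi> t))) (N \<Otimes>\<^sub>M borel) (\<lambda>(t, a). (\<phi> t, a))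
    = joint_law (distr P N \<phi>) K"
proof -
  have K\<phi>: "(\<lambda>t. K (\<phi> t)) \<in> P \<rightarrow>\<^sub>M prob_algebra borel"
    using \<phi> K by (rule measurable_compose)
  have Q: "prob_space (distr P N \<phi>)"
    by (rule prob_space.prob_space_distr[OF P \<phi>])
  have KQ: "K \<in> distr P N \<phi> \<rightarrow>\<^sub>M prob_algebra borel"
    using K by simp
  note sets1[measurable_cong] = sets_joint_law[OF P K\<phi>]
  have sets2: "sets (joint_law (distr P N \<phi>) K) = sets (N \<Otimes>\<^sub>M borel)"
    by (subst sets_joint_law[OF Q KQ]) (rule sets_pair_measure_cong; simp)
  have [measurable]: "\<phi> \<in> P \<rightarrow>\<^sub>M N" by (rule \<phi>)
  have \<theta>: "(\<lambda>(t, a). (\<phi> t, a)) \<in> joint_law P (\<lambda>t. K (\<phi> t)) \<rightarrow>\<^sub>M N \<Otimes>\<^sub>M borel"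
    by measurable
  show ?thesis
  proof (rule measure_eqI_rectangles)
    show "finite_measure (distr (joint_law P (\<lambda>t. K (\<phi> t))) (N \<Otimes>\<^sub>M borel) (\<lambda>(t, a). (\<phi> t, a)))"
      using prob_space.prob_space_distr[OF prob_space_joint_law[OF P K\<phi>] \<theta>]
      by (rule prob_space.finite_measure)
    fix A B assume AB: "A \<in> sets N" "B \<in> sets (borel :: 'c measure)"
    have [measurable]: "(\<lambda>x. emeasure (K x) B) \<in> borel_measurable N"
      by (rule measurable_emeasure_kernel[OF measurable_prob_algebraD[OF K] AB(2)])
    have "(\<lambda>(t, a). (\<phi> t, a)) -` (A \<times> B) \<inter> space (joint_law P (\<lambda>t. K (\<phi> t)))
        = (\<phi> -` A \<inter> space P) \<times> B"
      by (auto simp: sets_eq_imp_space_eq[OF sets1] space_pair_measure)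
    then have "emeasure (distr (joint_law P (\<lambda>t. K (\<phi> t))) (N \<Otimes>\<^sub>M borel) (\<lambda>(t, a). (\<phi> t, a))) (A \<times> B)
        = emeasure (joint_law P (\<lambda>t. K (\<phi> t))) ((\<phi> -` A \<inter> space P) \<times> B)"
      using AB by (simp add: emeasure_distr[OF \<theta>])
    also have "\<dots> = (\<integral>\<^sup>+t. indicator (\<phi> -` A \<inter> space P) t * emeasure (K (\<phi> t)) B \<partial>P)"
      using AB \<phi> by (intro emeasure_joint_law_Times[OF P K\<phi>]) auto
    also have "\<dots> = (\<integral>\<^sup>+t. indicator A (\<phi> t) * emeasure (K (\<phi> t)) B \<partial>P)"
      by (intro nn_integral_cong) (simp add: indicator_def)
    also have "\<dots> = (\<integral>\<^sup>+x. indicator A x * emeasure (K x) B \<partial>distr P N \<phi>)"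
      using AB by (subst nn_integral_distr[OF \<phi>]) auto
    also have "\<dots> = emeasure (joint_law (distr P N \<phi>) K) (A \<times> B)"
      using AB by (intro emeasure_joint_law_Times[OF Q KQ, symmetric]) auto
    finally show "emeasure (distr (joint_law P (\<lambda>t. K (\<phi> t))) (N \<Otimes>\<^sub>M borel) (\<lambda>(t, a). (\<phi> t, a))) (A \<times> B)
        = emeasure (joint_law (distr P N \<phi>) K) (A \<times> B)" .
  qed (simp_all add: sets2)
qed

section \<open>Relative entropy\<close>

text \<open>\<open>RN_deriv\<close> is determined only up to \<open>M\<close>-null sets, and these
  are null for \<open>density M f\<close> too. Hence any density at hand may replace the chosen one
  in the entropy density.\<close>

lemma extended_KL_divergence_density:
  assumes M: "sigma_finite_measure M" and f: "f \<in> borel_measurable M"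
  shows "extended_KL_divergence b M (density M f)
    = (if integrable (density M f) (\<lambda>x. log b (enn2real (f x)))
       then ereal (\<integral>x. log b (enn2real (f x)) \<partial>density M f) else \<infinity>)"
proof -
  interpret sigma_finite_measure M by fact
  have [measurable]: "f \<in> borel_measurable M" by (rule f)
  have ac: "absolutely_continuous M (density M f)"
    by (rule absolutely_continuousI_density[OF f])
  have "AE x in M. f x = RN_deriv M (density M f) x"
    by (rule RN_deriv_unique[OF f refl])
  then have ae: "AE x in density M f.
      entropy_density b M (density M f) x = log b (enn2real (f x))"
    by (intro absolutely_continuous_AE[OF _ ac]) (auto simp: entropy_density_def)
  have [measurable]: "entropy_density b M (density M f) \<in> borel_measurable M"
    unfolding entropy_density_def comp_def by measurable
  show ?thesis
    unfolding extended_KL_divergence_def KL_divergence_def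
    using integrable_cong_AE[OF _ _ ae] integral_cong_AE[OF _ _ ae] ac by simp
qed

lemma absolutely_continuous_distr:
  assumes ac: "absolutely_continuous M N" and sets: "sets N = sets M" and \<theta>: "\<theta> \<in> M \<rightarrow>\<^sub>M B"
  shows "absolutely_continuous (distr M B \<theta>) (distr N B \<theta>)"
proof -
  have \<theta>N: "\<theta> \<in> N \<rightarrow>\<^sub>M B"
    using \<theta> by (simp add: measurable_cong_sets[OF sets refl])
  show ?thesis
    using ac \<theta> \<theta>N sets_eq_imp_space_eq[OF sets]
    unfolding absolutely_continuous_def
    by (auto simp: null_sets_distr_iff subset_eq)
qed

text \<open>Data processing. With \<open>f = dN/dM\<close> and \<open>G\<close> the density of the image measures pulled back along
  \<open>\<theta>\<close>, the bounds \<open>1 - 1/G \<le> ln G \<le> G/f - 1 + ln f\<close> give both the integrability of \<open>ln G\<close> and,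
  since \<open>G/f\<close> has \<open>N\<close>-mean at most one, the inequality.\<close>

lemma extended_KL_divergence_distr_le:
  assumes b: "1 < b" and M: "prob_space M" and N: "prob_space N" and sets: "sets N = sets M"
    and \<theta>: "\<theta> \<in> M \<rightarrow>\<^sub>M B"
  shows "extended_KL_divergence b (distr M B \<theta>) (distr N B \<theta>) \<le> extended_KL_divergence b M N"
proof (cases "absolutely_continuous M N \<and> integrable N (entropy_density b M N)")
  case False
  then show ?thesis
    by (auto simp: extended_KL_divergence_def)
next
  case True
  interpret M: prob_space M by fact
  interpret N: prob_space N by fact
  note [measurable_cong] = sets
  have [measurable]: "\<theta> \<in> M \<rightarrow>\<^sub>M B" by (rule \<theta>)
  have \<theta>N: "\<theta> \<in> N \<rightarrow>\<^sub>M B" by measurable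
  interpret M': prob_space "distr M B \<theta>" by (rule M.prob_space_distr[OF \<theta>])
  interpret N': prob_space "distr N B \<theta>" by (rule N.prob_space_distr[OF \<theta>N])
  have ac: "absolutely_continuous M N" using True by simp
  have ac': "absolutely_continuous (distr M B \<theta>) (distr N B \<theta>)"
    by (rule absolutely_continuous_distr[OF ac sets \<theta>])
  \<comment> \<open>A real-valued version of the density, nonnegative everywhere and positive
    \<open>N\<close>-almost everywhere, so that quotients and logarithms can be formed.\<close>
  obtain f where f[measurable]: "f \<in> borel_measurable M"
    and f_RN: "AE x in M. RN_deriv M N x = ennreal (f x)"
    and f_pos: "AE x in N. 0 < f x" and f_nn: "\<And>x. 0 \<le> f x"
    by (rule M.real_RN_deriv[OF N.finite_measure_axioms ac sets]) blast
  have Nd: "N = density M (\<lambda>x. ennreal (f x))"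
    using M.density_RN_deriv[OF ac sets] density_cong[OF _ _ f_RN] by simp
  obtain g where g[measurable]: "g \<in> borel_measurable (distr M B \<theta>)"
    and g_RN: "AE x in distr M B \<theta>. RN_deriv (distr M B \<theta>) (distr N B \<theta>) x = ennreal (g x)"
    and g_pos: "AE x in distr N B \<theta>. 0 < g x" and g_nn: "\<And>x. 0 \<le> g x"
    by (rule M'.real_RN_deriv[OF N'.finite_measure_axioms ac']) (simp, blast)
  have Nd': "distr N B \<theta> = density (distr M B \<theta>) (\<lambda>x. ennreal (g x))"
    using M'.density_RN_deriv[OF ac'] density_cong[OF _ _ g_RN] by simp
  have gB[measurable]: "g \<in> borel_measurable B"
    using g by simp
  define G where "G x = g (\<theta> x)" for x
  have [measurable]: "G \<in> borel_measurable M"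
    unfolding G_def by measurable
  have G_pos: "AE x in N. 0 < G x"
    using AE_distrD[OF \<theta>N g_pos] by (simp add: G_def)
  \<comment> \<open>On the image space the weight \<open>g\<close> cancels \<open>1 / g\<close>. The
    result is at most one rather than equal to it, because \<open>1 / 0 = 0\<close> where
    \<open>g\<close> vanishes.\<close>
  have "(\<integral>\<^sup>+x. ennreal (1 / G x) \<partial>N) = (\<integral>\<^sup>+y. ennreal (1 / g y) \<partial>distr N B \<theta>)"
    unfolding G_def by (subst nn_integral_distr[OF \<theta>N]) simp_all
  also have "\<dots> = (\<integral>\<^sup>+y. ennreal (g y) * ennreal (1 / g y) \<partial>distr M B \<theta>)"
    unfolding Nd' by (subst nn_integral_density) simp_all
  also have "\<dots> \<le> (\<integral>\<^sup>+y. 1 \<partial>distr M B \<theta>)"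
    using g_nn by (intro nn_integral_mono) (simp add: ennreal_mult'[symmetric])
  also have "\<dots> = 1"
    using M'.emeasure_space_1 by simp
  finally have int1: "integrable N (\<lambda>x. 1 / G x)"
    using g_nn by (intro integrableI_bounded) (auto simp: G_def intro: le_less_trans)
  \<comment> \<open>The same cancellation with weight \<open>f\<close>, again losing the set where
    \<open>f\<close> vanishes; what remains is at most the \<open>M\<close>-integral of
    \<open>G\<close>, the total mass of the image of \<open>N\<close>.\<close>
  have "(\<integral>\<^sup>+x. ennreal (G x / f x) \<partial>N) = (\<integral>\<^sup>+x. ennreal (f x) * ennreal (G x / f x) \<partial>M)"
    unfolding Nd by (subst nn_integral_density) simp_all
  also have "\<dots> \<le> (\<integral>\<^sup>+x. ennreal (G x) \<partial>M)"
    using f_nn g_nn by (intro nn_integral_mono) (simp add: ennreal_mult'[symmetric] G_def)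
  also have "\<dots> = (\<integral>\<^sup>+y. ennreal (g y) \<partial>distr M B \<theta>)"
    unfolding G_def by (subst nn_integral_distr[OF \<theta>]) simp_all
  also have "\<dots> = emeasure (distr N B \<theta>) (space B)"
    unfolding Nd' by (subst emeasure_density) (auto intro!: nn_integral_cong simp: g)
  also have "\<dots> = 1"
    using N'.emeasure_space_1 by simp
  finally have le1: "(\<integral>\<^sup>+x. ennreal (G x / f x) \<partial>N) \<le> 1" .
  then have int2: "integrable N (\<lambda>x. G x / f x)"
    using f_nn g_nn by (intro integrableI_bounded) (auto simp: G_def intro: le_less_trans)
  have "ennreal (\<integral>x. G x / f x \<partial>N) \<le> 1"
    using le1 f_nn g_nn by (subst nn_integral_eq_integral[symmetric, OF int2]) (auto simp: G_def)
  then have mean: "(\<integral>x. G x / f x \<partial>N) \<le> 1"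
    by (simp add: ennreal_le_1)
  have KL: "extended_KL_divergence b M N
      = (if integrable N (\<lambda>x. log b (f x)) then ereal (\<integral>x. log b (f x) \<partial>N) else \<infinity>)"
    using extended_KL_divergence_density[OF M.sigma_finite_measure_axioms, of "\<lambda>x. ennreal (f x)" b] f_nn
    by (simp add: Nd[symmetric])
  have "extended_KL_divergence b (distr M B \<theta>) (distr N B \<theta>)
      = (if integrable (distr N B \<theta>) (\<lambda>x. log b (g x)) then ereal (\<integral>x. log b (g x) \<partial>distr N B \<theta>) else \<infinity>)"
    using extended_KL_divergence_density[OF M'.sigma_finite_measure_axioms, of "\<lambda>x. ennreal (g x)" b] g_nn
    by (simp add: Nd'[symmetric])
  also have "\<dots> = (if integrable N (\<lambda>x. log b (G x)) then ereal (\<integral>x. log b (G x) \<partial>N) else \<infinity>)"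
    by (simp add: integrable_distr_eq[OF \<theta>N] integral_distr[OF \<theta>N] G_def)
  finally have KL': "extended_KL_divergence b (distr M B \<theta>) (distr N B \<theta>)
      = (if integrable N (\<lambda>x. log b (G x)) then ereal (\<integral>x. log b (G x) \<partial>N) else \<infinity>)" .
  \<comment> \<open>By \<open>KL\<close>, a non-integrable \<open>log b (f x)\<close> would make the
    divergence infinite, whereas \<open>True\<close> makes it finite.\<close>
  have intf: "integrable N (\<lambda>x. log b (f x))"
    using True KL by (auto simp: extended_KL_divergence_def split: if_splits)
  then have intlf: "integrable N (\<lambda>x. ln (f x))"
    using b integrable_mult_right[OF intf, of "ln b"] by (simp add: log_def)
  \<comment> \<open>Both bounds are \<open>ln s \<le> s - 1\<close>, taken at
    \<open>s = G x / f x\<close> here and at \<open>s = 1 / G x\<close> next.\<close>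
  have up: "AE x in N. ln (G x) \<le> G x / f x - 1 + ln (f x)"
    using f_pos G_pos
  proof eventually_elim
    case (elim x)
    then show ?case
      using ln_le_minus_one[of "G x / f x"] by (simp add: ln_div)
  qed
  have lo: "AE x in N. 1 - 1 / G x \<le> ln (G x)"
    using G_pos
  proof eventually_elim
    case (elim x)
    then show ?case
      using ln_le_minus_one[of "1 / G x"] by (simp add: ln_div)
  qed
  have intG: "integrable N (\<lambda>x. ln (G x))"
  proof (rule Bochner_Integration.integrable_bound)
    show "integrable N (\<lambda>x. \<bar>1 / G x\<bar> + 1 + \<bar>G x / f x\<bar> + \<bar>ln (f x)\<bar>)"
      using int1 int2 intlf by (intro Bochner_Integration.integrable_add integrable_abs) simp_all
    show "AE x in N. norm (ln (G x)) \<le> norm (\<bar>1 / G x\<bar> + 1 + \<bar>G x / f x\<bar> + \<bar>ln (f x)\<bar>)"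
      using up lo by eventually_elim (unfold real_norm_def, linarith)
  qed measurable
  have "(\<integral>x. ln (G x) \<partial>N) \<le> (\<integral>x. G x / f x - 1 + ln (f x) \<partial>N)"
    using int2 intlf by (intro integral_mono_AE intG up) auto
  also have "\<dots> = (\<integral>x. G x / f x \<partial>N) - 1 + (\<integral>x. ln (f x) \<partial>N)"
    using int2 intlf by (simp add: N.prob_space)
  also have "\<dots> \<le> (\<integral>x. ln (f x) \<partial>N)"
    using mean by simp
  finally have "(\<integral>x. log b (G x) \<partial>N) \<le> (\<integral>x. log b (f x) \<partial>N)"
    using b by (simp add: log_def divide_right_mono)
  moreover have "integrable N (\<lambda>x. log b (G x))"
    using intG by (simp add: log_def)
  ultimately show ?thesis
    by (simp add: KL KL' intf)
qed

section \<open>Rate--distortion functions\<close>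

text \<open>Tonelli, with the indicator of \<open>A\<close> pulled out so that the right-hand side
  has the shape of \<open>emeasure_joint_law_Times\<close>: section integrals of the density then
  compare directly with kernel values.\<close>

lemma emeasure_density_pair_Times:
  assumes R: "sigma_finite_measure R" and f: "f \<in> borel_measurable (Q \<Otimes>\<^sub>M R)"
    and A: "A \<in> sets Q" and B: "B \<in> sets R"
  shows "emeasure (density (Q \<Otimes>\<^sub>M R) f) (A \<times> B)
    = (\<integral>\<^sup>+x. indicator A x * (\<integral>\<^sup>+a. f (x, a) * indicator B a \<partial>R) \<partial>Q)"
proof -
  interpret R: sigma_finite_measure R by fact
  note [measurable] = f A B
  have "emeasure (density (Q \<Otimes>\<^sub>M R) f) (A \<times> B)
      = (\<integral>\<^sup>+z. f z * indicator (A \<times> B) z \<partial>(Q \<Otimes>\<^sub>M R))"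
    by (rule emeasure_density) measurable
  also have "\<dots> = (\<integral>\<^sup>+x. \<integral>\<^sup>+a. f (x, a) * indicator (A \<times> B) (x, a) \<partial>R \<partial>Q)"
    by (subst R.nn_integral_fst[symmetric]) simp_all
  also have "\<dots> = (\<integral>\<^sup>+x. indicator A x * (\<integral>\<^sup>+a. f (x, a) * indicator B a \<partial>R) \<partial>Q)"
  proof (rule nn_integral_cong)
    fix x assume x: "x \<in> space Q"
    show "(\<integral>\<^sup>+a. f (x, a) * indicator (A \<times> B) (x, a) \<partial>R)
        = indicator A x * (\<integral>\<^sup>+a. f (x, a) * indicator B a \<partial>R)"
      by (cases "x \<in> A") (simp_all add: indicator_times)
  qed
  finally show ?thesis .
qed

text \<open>A joint law dominated by the product of its marginals disintegrates by normalizing the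
  sections of its density, so that no regular conditional probabilities are needed.\<close>

lemma ex_kernel_of_density:
  fixes R :: "'b::topological_space measure"
  assumes Q: "prob_space Q" and R: "prob_space R" "sets R = sets borel"
    and f: "f \<in> borel_measurable (Q \<Otimes>\<^sub>M R)"
    and marginal: "distr (density (Q \<Otimes>\<^sub>M R) f) Q fst = Q"
  shows "\<exists>K \<in> Q \<rightarrow>\<^sub>M prob_algebra borel. joint_law Q K = density (Q \<Otimes>\<^sub>M R) f"
proof -
  interpret Q: prob_space Q by fact
  interpret R: prob_space R by fact
  note [measurable] = f
  note sigma_R = R.sigma_finite_measure_axioms
  have spR: "space R = UNIV"
    using sets_eq_imp_space_eq[OF R(2)] by simp
  define k where "k x = (\<integral>\<^sup>+a. f (x, a) \<partial>R)" for x
  have k_meas[measurable]: "k \<in> borel_measurable Q"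
    unfolding k_def by measurable
  \<comment> \<open>The first marginal has density \<open>k\<close> with respect to \<open>Q\<close>
    and is \<open>Q\<close> by assumption, so almost every section has mass one.\<close>
  have "density Q k = density Q (\<lambda>_. 1)"
  proof (rule measure_eqI)
    fix A assume "A \<in> sets (density Q k)"
    then have A: "A \<in> sets Q"
      by simp
    have "emeasure (density Q k) A = (\<integral>\<^sup>+x. indicator A x * (\<integral>\<^sup>+a. f (x, a) * indicator UNIV a \<partial>R) \<partial>Q)"
      using A by (simp add: emeasure_density k_def mult.commute)
    also have "\<dots> = emeasure (density (Q \<Otimes>\<^sub>M R) f) (A \<times> UNIV)"
      using A R(2) by (intro emeasure_density_pair_Times[OF sigma_R f, symmetric]) simp_all
    also have "\<dots> = emeasure (distr (density (Q \<Otimes>\<^sub>M R) f) Q fst) A"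
      using A sets.sets_into_space[OF A]
      by (subst emeasure_distr) (auto simp: space_pair_measure spR intro!: arg_cong2[where f = emeasure])
    finally show "emeasure (density Q k) A = emeasure (density Q (\<lambda>_. 1)) A"
      by (simp add: marginal density_1)
  qed simp
  then have k_1: "AE x in Q. k x = 1"
    by (subst (asm) Q.density_unique_iff) simp_all
  \<comment> \<open>On the null set of sections of the wrong mass, \<open>R\<close> serves as an
    arbitrary probability measure, which makes \<open>K\<close> a Markov kernel at every
    point.\<close>
  define K where "K x = (if k x = 1 then density R (\<lambda>a. f (x, a)) else R)" for x
  have section_meas: "(\<lambda>a. f (x, a)) \<in> borel_measurable R" if "x \<in> space Q" for x
    using that by measurable
  have emeasure_K: "emeasure (K x) B
      = (if k x = 1 then \<integral>\<^sup>+a. f (x, a) * indicator B a \<partial>R else emeasure R B)"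
    if "x \<in> space Q" "B \<in> sets R" for x B
    using that section_meas by (simp add: K_def emeasure_density)
  have prob_K: "prob_space (K x)" if x: "x \<in> space Q" for x
  proof (cases "k x = 1")
    case True
    then have "emeasure (K x) (space (K x)) = k x"
      using emeasure_K[OF x sets.top] by (simp add: K_def spR k_def)
    then show ?thesis
      using True by (intro prob_spaceI) simp
  qed (simp add: K_def R(1))
  have K: "K \<in> Q \<rightarrow>\<^sub>M prob_algebra borel"
  proof (intro measurable_prob_algebraI measurable_subprob_algebra)
    fix B :: "'b set" assume "B \<in> sets borel"
    then have B[measurable]: "B \<in> sets R"
      using R(2) by simp
    show "(\<lambda>x. emeasure (K x) B) \<in> borel_measurable Q"
      by (subst measurable_cong[OF emeasure_K[OF _ B]]) measurable
  qed (use prob_K R(2) in \<open>simp_all add: prob_space_imp_subprob_space, simp add: K_def\<close>)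
  have "joint_law Q K = density (Q \<Otimes>\<^sub>M R) f"
  proof (rule measure_eqI_rectangles)
    show "sets (joint_law Q K) = sets (Q \<Otimes>\<^sub>M borel)"
      by (rule sets_joint_law[OF Q K])
    show "sets (density (Q \<Otimes>\<^sub>M R) f) = sets (Q \<Otimes>\<^sub>M borel)"
      using R(2) by (simp cong: sets_pair_measure_cong)
    show "finite_measure (joint_law Q K)"
      by (rule prob_space.finite_measure[OF prob_space_joint_law[OF Q K]])
    fix A and B :: "'b set" assume A: "A \<in> sets Q" and B: "B \<in> sets borel"
    have "emeasure (joint_law Q K) (A \<times> B) = (\<integral>\<^sup>+x. indicator A x * emeasure (K x) B \<partial>Q)"
      by (rule emeasure_joint_law_Times[OF Q K A B])
    also have "\<dots> = (\<integral>\<^sup>+x. indicator A x * (\<integral>\<^sup>+a. f (x, a) * indicator B a \<partial>R) \<partial>Q)"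
    proof (rule nn_integral_cong_AE)
      show "AE x in Q. indicator A x * emeasure (K x) B
          = indicator A x * (\<integral>\<^sup>+a. f (x, a) * indicator B a \<partial>R)"
        using k_1 AE_space by eventually_elim (simp add: emeasure_K B R(2))
    qed
    also have "\<dots> = emeasure (density (Q \<Otimes>\<^sub>M R) f) (A \<times> B)"
      using B R(2) by (intro emeasure_density_pair_Times[OF sigma_R f A, symmetric]) simp
    finally show "emeasure (joint_law Q K) (A \<times> B) = emeasure (density (Q \<Otimes>\<^sub>M R) f) (A \<times> B)" .
  qed
  with K show ?thesis
    by blast
qed

section \<open>Transport along \<open>\<phi>\<close> and mutual information\<close>

lemma distr_snd_map_prod:
  assumes sets: "sets J = sets (P \<Otimes>\<^sub>M L)" and \<phi>: "\<phi> \<in> P \<rightarrow>\<^sub>M N"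
  shows "distr (distr J (N \<Otimes>\<^sub>M L) (\<lambda>(t, a). (\<phi> t, a))) L snd = distr J L snd"
proof -
  note [measurable_cong] = sets
  note [measurable] = \<phi>
  show ?thesis
    by (subst distr_distr) (auto intro!: distr_cong simp: comp_def)
qed

lemma distr_pair_map_fst:
  assumes \<phi>: "\<phi> \<in> P \<rightarrow>\<^sub>M N" and R: "prob_space R" "sets R = sets L"
  shows "distr P N \<phi> \<Otimes>\<^sub>M R = distr (P \<Otimes>\<^sub>M R) (N \<Otimes>\<^sub>M L) (\<lambda>(t, a). (\<phi> t, a))"
proof -
  have "distr R L (\<lambda>a. a) = R"
    using R(2) by (simp add: distr_id2)
  then show ?thesis
    using pair_measure_distr[OF \<phi>, of "\<lambda>a. a" R L] R
    by (simp add: prob_space_imp_sigma_finite measurable_ident_sets)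
qed

text \<open>Data processing along \<open>\<phi>\<close> yields the opposite inequality; this
  direction rests on the kernel depending on \<open>t\<close> only through \<open>\<phi> t\<close>.
  If \<open>J\<close> is dominated by the product of its marginals, the proof gives equality;
  otherwise the right-hand side is infinite.\<close>

lemma mutual_information_kernel_comp_le:
  assumes P: "prob_space P" and \<phi>: "\<phi> \<in> P \<rightarrow>\<^sub>M N" and K: "K \<in> N \<rightarrow>\<^sub>M prob_algebra borel"
  defines "Q \<equiv> distr P N \<phi>"
  shows "extended_mutual_information b (joint_law P (\<lambda>t. K (\<phi> t))) P borel fst snd
    \<le> extended_mutual_information b (joint_law Q K) Q borel fst snd"
proof -
  define J where "J = joint_law Q K"
  define J1 where "J1 = joint_law P (\<lambda>t. K (\<phi> t))"
  define R where "R = distr J borel snd"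
  define \<theta> where "\<theta> = (\<lambda>(t, a :: 'c). (\<phi> t, a))"
  have K\<phi>: "(\<lambda>t. K (\<phi> t)) \<in> P \<rightarrow>\<^sub>M prob_algebra borel"
    using \<phi> K by (rule measurable_compose)
  have Q: "prob_space Q"
    unfolding Q_def by (rule prob_space.prob_space_distr[OF P \<phi>])
  have sets_Q: "sets Q = sets N"
    by (simp add: Q_def)
  have KQ: "K \<in> Q \<rightarrow>\<^sub>M prob_algebra borel"
    using K by (simp add: Q_def)
  have sets_J: "sets J = sets (Q \<Otimes>\<^sub>M borel)"
    unfolding J_def by (rule sets_joint_law[OF Q KQ])
  have sets_J1: "sets J1 = sets (P \<Otimes>\<^sub>M borel)"
    unfolding J1_def by (rule sets_joint_law[OF P K\<phi>])
  have J: "prob_space J"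
    unfolding J_def by (rule prob_space_joint_law[OF Q KQ])
  have "snd \<in> J \<rightarrow>\<^sub>M borel"
    by (simp add: measurable_cong_sets[OF sets_J refl])
  then have R: "prob_space R"
    unfolding R_def by (rule prob_space.prob_space_distr[OF J])
  have sets_R[measurable_cong]: "sets R = sets borel"
    by (simp add: R_def)
  interpret P: prob_space P by (rule P)
  interpret Q: prob_space Q by (rule Q)
  interpret R: prob_space R by (rule R)
  interpret QR: pair_prob_space Q R ..
  interpret PR: pair_prob_space P R ..
  note sigma_R = R.sigma_finite_measure_axioms
  note [measurable] = \<phi>
  have \<theta>[measurable]: "\<theta> \<in> P \<Otimes>\<^sub>M R \<rightarrow>\<^sub>M N \<Otimes>\<^sub>M R"
    unfolding \<theta>_def by measurable
  have \<theta>J1: "\<theta> \<in> J1 \<rightarrow>\<^sub>M N \<Otimes>\<^sub>M borel"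
    unfolding \<theta>_def measurable_cong_sets[OF sets_J1 refl] by measurable
  have J_distr: "J = distr J1 (N \<Otimes>\<^sub>M borel) \<theta>"
    unfolding J_def J1_def \<theta>_def Q_def by (rule joint_law_distr[OF P \<phi> K, symmetric])
  \<comment> \<open>Both joint laws have the same reproduction marginal, so the two reference
    products differ in the source factor only.\<close>
  have R_J1: "R = distr J1 borel snd"
    unfolding R_def J_distr \<theta>_def by (rule distr_snd_map_prod[OF sets_J1 \<phi>])
  have I: "extended_mutual_information b J Q borel fst snd = extended_KL_divergence b (Q \<Otimes>\<^sub>M R) J"
    unfolding J_def R_def by (rule mutual_information_joint_law[OF Q KQ])
  have I1: "extended_mutual_information b J1 P borel fst snd = extended_KL_divergence b (P \<Otimes>\<^sub>M R) J1"
    unfolding J1_def R_J1 by (rule mutual_information_joint_law[OF P K\<phi>])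
  show ?thesis
  proof (cases "absolutely_continuous (Q \<Otimes>\<^sub>M R) J")
    case False
    then show ?thesis
      unfolding J_def[symmetric] I by (simp add: extended_KL_divergence_def)
  next
    case True
    define f where "f = RN_deriv (Q \<Otimes>\<^sub>M R) J"
    have f: "f \<in> borel_measurable (Q \<Otimes>\<^sub>M R)"
      by (simp add: f_def)
    have sets_eq: "sets J = sets (Q \<Otimes>\<^sub>M R)"
      by (simp add: sets_J sets_R cong: sets_pair_measure_cong)
    have J_dens: "J = density (Q \<Otimes>\<^sub>M R) f"
      unfolding f_def by (rule QR.density_RN_deriv[OF True sets_eq, symmetric])
    have sets_QR: "sets (Q \<Otimes>\<^sub>M R) = sets (N \<Otimes>\<^sub>M R)"
      by (simp add: sets_Q cong: sets_pair_measure_cong)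
    have fN[measurable]: "f \<in> borel_measurable (N \<Otimes>\<^sub>M R)"
      using f by (simp add: measurable_cong_sets[OF sets_QR refl])
    have f\<theta>: "(\<lambda>z. f (\<theta> z)) \<in> borel_measurable (P \<Otimes>\<^sub>M R)"
      by measurable
    \<comment> \<open>The null set may depend on \<open>B\<close>: each \<open>B\<close> is used on its own.\<close>
    have K_dens: "AE x in Q. emeasure (K x) B = (\<integral>\<^sup>+a. f (x, a) * indicator B a \<partial>R)"
      if B: "B \<in> sets borel" for B
    proof -
      have B'[measurable]: "B \<in> sets R"
        using B by (simp add: sets_R)
      note [measurable] = f
      have m1[measurable]: "(\<lambda>x. emeasure (K x) B) \<in> borel_measurable Q"
        by (rule measurable_emeasure_kernel[OF measurable_prob_algebraD[OF KQ] B])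
      have m2[measurable]: "(\<lambda>x. \<integral>\<^sup>+a. f (x, a) * indicator B a \<partial>R) \<in> borel_measurable Q"
        by measurable
      \<comment> \<open>Both functions are densities with respect to \<open>Q\<close> of the measure
        sending \<open>A\<close> to \<open>emeasure J (A \<times> B)\<close>, hence they agree
        almost everywhere.\<close>
      have "density Q (\<lambda>x. emeasure (K x) B) = density Q (\<lambda>x. \<integral>\<^sup>+a. f (x, a) * indicator B a \<partial>R)"
      proof (rule measure_eqI)
        fix A assume "A \<in> sets (density Q (\<lambda>x. emeasure (K x) B))"
        then have A: "A \<in> sets Q"
          by simp
        have "emeasure (density Q (\<lambda>x. emeasure (K x) B)) A = emeasure J (A \<times> B)"
          using A unfolding J_def emeasure_joint_law_Times[OF Q KQ A B]
          by (simp add: emeasure_density mult.commute)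
        also have "\<dots> = emeasure (density Q (\<lambda>x. \<integral>\<^sup>+a. f (x, a) * indicator B a \<partial>R)) A"
          using A unfolding J_dens emeasure_density_pair_Times[OF sigma_R f A B']
          by (simp add: emeasure_density mult.commute)
        finally show "emeasure (density Q (\<lambda>x. emeasure (K x) B)) A
            = emeasure (density Q (\<lambda>x. \<integral>\<^sup>+a. f (x, a) * indicator B a \<partial>R)) A" .
      qed simp
      then show ?thesis
        by (subst (asm) Q.density_unique_iff[OF m1 m2])
    qed
    \<comment> \<open>Here \<open>A\<close> need not be a preimage under \<open>\<phi>\<close>, so
      the masses of \<open>J\<close> on rectangles do not suffice; the pointwise formula
      \<open>K_dens\<close>, pulled back along \<open>\<phi>\<close>, does.\<close>
    have J1_dens: "J1 = density (P \<Otimes>\<^sub>M R) (\<lambda>z. f (\<theta> z))"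
    proof (rule measure_eqI_rectangles)
      show "sets (density (P \<Otimes>\<^sub>M R) (\<lambda>z. f (\<theta> z))) = sets (P \<Otimes>\<^sub>M borel)"
        by (simp add: sets_R cong: sets_pair_measure_cong)
      show "finite_measure J1"
        unfolding J1_def by (rule prob_space.finite_measure[OF prob_space_joint_law[OF P K\<phi>]])
      fix A and B :: "'c set" assume A: "A \<in> sets P" and B: "B \<in> sets borel"
      have B': "B \<in> sets R"
        using B by (simp add: sets_R)
      have ae: "AE t in P. emeasure (K (\<phi> t)) B = (\<integral>\<^sup>+a. f (\<phi> t, a) * indicator B a \<partial>R)"
        using K_dens[OF B] unfolding Q_def by (rule AE_distrD[OF \<phi>])
      have "emeasure J1 (A \<times> B) = (\<integral>\<^sup>+t. indicator A t * emeasure (K (\<phi> t)) B \<partial>P)"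
        unfolding J1_def by (rule emeasure_joint_law_Times[OF P K\<phi> A B])
      also have "\<dots> = (\<integral>\<^sup>+t. indicator A t * (\<integral>\<^sup>+a. f (\<theta> (t, a)) * indicator B a \<partial>R) \<partial>P)"
      proof (rule nn_integral_cong_AE)
        show "AE t in P. indicator A t * emeasure (K (\<phi> t)) B
            = indicator A t * (\<integral>\<^sup>+a. f (\<theta> (t, a)) * indicator B a \<partial>R)"
          using ae by eventually_elim (simp add: \<theta>_def)
      qed
      also have "\<dots> = emeasure (density (P \<Otimes>\<^sub>M R) (\<lambda>z. f (\<theta> z))) (A \<times> B)"
        by (rule emeasure_density_pair_Times[OF sigma_R f\<theta> A B', symmetric])
      finally show "emeasure J1 (A \<times> B) = emeasure (density (P \<Otimes>\<^sub>M R) (\<lambda>z. f (\<theta> z))) (A \<times> B)" .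
    qed (rule sets_J1)
    define h where "h z = log b (enn2real (f z))" for z
    then have h_abs: "h = (\<lambda>z. log b (enn2real (f z)))"
      by (simp add: fun_eq_iff)
    have "sets (N \<Otimes>\<^sub>M R) = sets (N \<Otimes>\<^sub>M borel)"
      by (simp add: sets_R cong: sets_pair_measure_cong)
    from measurable_cong_sets[OF this refl] have h: "h \<in> borel_measurable (N \<Otimes>\<^sub>M borel)"
      unfolding h_def using fN by simp
    \<comment> \<open>The log-densities are \<open>h \<circ> \<theta>\<close> and \<open>h\<close>,
      and \<open>J\<close> is the image of \<open>J1\<close> under \<open>\<theta>\<close>, so
      integrability and integral agree.\<close>
    have "extended_KL_divergence b (P \<Otimes>\<^sub>M R) J1
        = (if integrable J1 (\<lambda>z. h (\<theta> z)) then ereal (\<integral>z. h (\<theta> z) \<partial>J1) else \<infinity>)"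
      using extended_KL_divergence_density[OF PR.sigma_finite_measure_axioms f\<theta>, of b]
      by (simp add: J1_dens[symmetric] h_def)
    also have "\<dots> = (if integrable J h then ereal (\<integral>z. h z \<partial>J) else \<infinity>)"
      unfolding J_distr by (simp add: integrable_distr_eq[OF \<theta>J1 h] integral_distr[OF \<theta>J1 h])
    also have "\<dots> = extended_KL_divergence b (Q \<Otimes>\<^sub>M R) J"
      using extended_KL_divergence_density[OF QR.sigma_finite_measure_axioms f, of b]
      unfolding J_dens[symmetric] h_abs[symmetric] by simp
    finally show ?thesis
      by (simp add: I I1 flip: J_def J1_def)
  qed
qed

section \<open>Comparison of rate-distortion functions along \<open>\<phi>\<close>\<close>

text \<open>An admissible \<open>K\<close> for the image source makes
  \<open>K \<circ> \<phi>\<close> admissible for \<open>P\<close>: its expected distortion is at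
  most \<open>c * (D / c)\<close>, and its rate is no larger. Nonnegativity of \<open>d\<close> lets
  domination by \<open>c * e\<close> give integrability.\<close>

lemma rate_distortion_le_rate_distortion_distr:
  assumes P: "prob_space P" and \<phi>: "\<phi> \<in> P \<rightarrow>\<^sub>M N"
    and d: "(\<lambda>(t, a). d t a) \<in> borel_measurable (P \<Otimes>\<^sub>M borel)"
    and c: "0 < c"
    and d_nn: "\<And>t a. t \<in> space P \<Longrightarrow> 0 \<le> d t a"
    and d_le: "\<And>t a. t \<in> space P \<Longrightarrow> d t a \<le> c * e (\<phi> t) a"
  shows "rate_distortion b P d D \<le> rate_distortion b (distr P N \<phi>) e (D / c)"
  unfolding rate_distortion_def[of b "distr P N \<phi>"]
proof (rule Inf_greatest, clarify)
  fix K assume "K \<in> distr P N \<phi> \<rightarrow>\<^sub>M prob_algebra borel"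
    and int: "integrable (joint_law (distr P N \<phi>) K) (\<lambda>(x, a). e x a)"
    and le: "(\<integral>(x, a). e x a \<partial>joint_law (distr P N \<phi>) K) \<le> D / c"
  then have K: "K \<in> N \<rightarrow>\<^sub>M prob_algebra borel"
    by simp
  have K\<phi>: "(\<lambda>t. K (\<phi> t)) \<in> P \<rightarrow>\<^sub>M prob_algebra borel"
    using \<phi> K by (rule measurable_compose)
  define J1 where "J1 = joint_law P (\<lambda>t. K (\<phi> t))"
  have sets_J1: "sets J1 = sets (P \<Otimes>\<^sub>M borel)"
    unfolding J1_def by (rule sets_joint_law[OF P K\<phi>])
  have \<theta>: "(\<lambda>(t, a). (\<phi> t, a)) \<in> J1 \<rightarrow>\<^sub>M N \<Otimes>\<^sub>M borel"
    unfolding measurable_cong_sets[OF sets_J1 refl] using \<phi> by measurable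
  have J: "joint_law (distr P N \<phi>) K = distr J1 (N \<Otimes>\<^sub>M borel) (\<lambda>(t, a). (\<phi> t, a))"
    unfolding J1_def by (rule joint_law_distr[OF P \<phi> K, symmetric])
  \<comment> \<open>Measurability of \<open>e\<close> comes from integrability under the admissible
    kernel.\<close>
  have e: "(\<lambda>(x, a). e x a) \<in> borel_measurable (N \<Otimes>\<^sub>M borel)"
    using borel_measurable_integrable[OF int] by (simp add: J)
  have int1: "integrable J1 (\<lambda>(t, a). e (\<phi> t) a)"
    using int unfolding J by (subst (asm) integrable_distr_eq[OF \<theta> e]) (simp add: case_prod_unfold)
  have le1: "(\<integral>(t, a). e (\<phi> t) a \<partial>J1) \<le> D / c"
    using le unfolding J by (subst (asm) integral_distr[OF \<theta> e]) (simp add: case_prod_unfold)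
  have space_J1: "space J1 = space P \<times> UNIV"
    using sets_eq_imp_space_eq[OF sets_J1] by (simp add: space_pair_measure)
  have bnd: "0 \<le> (case z of (t, a) \<Rightarrow> d t a)"
      "(case z of (t, a) \<Rightarrow> d t a) \<le> c * (case z of (t, a) \<Rightarrow> e (\<phi> t) a)" if "z \<in> space J1" for z
    using that d_nn d_le by (auto simp: space_J1)
  have intd: "integrable J1 (\<lambda>(t, a). d t a)"
  proof (rule Bochner_Integration.integrable_bound)
    show "integrable J1 (\<lambda>z. c * (case z of (t, a) \<Rightarrow> e (\<phi> t) a))"
      using int1 by simp
    show "(\<lambda>(t, a). d t a) \<in> borel_measurable J1"
      unfolding measurable_cong_sets[OF sets_J1 refl] by (rule d)
  qed (use bnd in fastforce)
  have "(\<integral>(t, a). d t a \<partial>J1) \<le> (\<integral>z. c * (case z of (t, a) \<Rightarrow> e (\<phi> t) a) \<partial>J1)"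
    using int1 by (intro integral_mono intd bnd) simp_all
  also have "\<dots> \<le> D"
    using le1 c by (simp add: field_simps)
  finally have "rate_distortion b P d D \<le> extended_mutual_information b J1 P borel fst snd"
    unfolding rate_distortion_def using K\<phi> intd J1_def by (intro Inf_lower) blast
  also have "\<dots> \<le> extended_mutual_information b (joint_law (distr P N \<phi>) K) (distr P N \<phi>) borel fst snd"
    unfolding J1_def by (rule mutual_information_kernel_comp_le[OF P \<phi> K])
  finally show "rate_distortion b P d D
      \<le> extended_mutual_information b (joint_law (distr P N \<phi>) K) (distr P N \<phi>) borel fst snd" .
qed

text \<open>A kernel from \<open>P\<close> need not factor through \<open>\<phi>\<close>, so the new
  kernel is recovered from the image \<open>J'\<close> of the joint law instead. Expected distortion
  is computed on \<open>J'\<close> by change of variables, and data processing bounds the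
  rate.\<close>

lemma rate_distortion_distr_le_rate_distortion:
  assumes b: "1 < b" and P: "prob_space P" and \<phi>: "\<phi> \<in> P \<rightarrow>\<^sub>M N"
    and e: "(\<lambda>(x, a). e x a) \<in> borel_measurable (N \<Otimes>\<^sub>M borel)"
    and c: "0 < c"
    and e_nn: "\<And>t a. t \<in> space P \<Longrightarrow> 0 \<le> e (\<phi> t) a"
    and e_le: "\<And>t a. t \<in> space P \<Longrightarrow> c * e (\<phi> t) a \<le> d t a"
  shows "rate_distortion b (distr P N \<phi>) e (D / c) \<le> rate_distortion b P d D"
  unfolding rate_distortion_def[of b P]
proof (rule Inf_greatest, clarify)
  define Q where "Q = distr P N \<phi>"
  fix K assume K: "K \<in> P \<rightarrow>\<^sub>M prob_algebra borel"
    and int: "integrable (joint_law P K) (\<lambda>(t, a). d t a)"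
    and le: "(\<integral>(t, a). d t a \<partial>joint_law P K) \<le> D"
  define J where "J = joint_law P K"
  define \<theta> where "\<theta> = (\<lambda>(t, a :: 'c). (\<phi> t, a))"
  define J' where "J' = distr J (N \<Otimes>\<^sub>M borel) \<theta>"
  define R where "R = distr J borel snd"
  have J: "prob_space J"
    unfolding J_def by (rule prob_space_joint_law[OF P K])
  have sets_J: "sets J = sets (P \<Otimes>\<^sub>M borel)"
    unfolding J_def by (rule sets_joint_law[OF P K])
  have "snd \<in> J \<rightarrow>\<^sub>M borel"
    by (simp add: measurable_cong_sets[OF sets_J refl])
  then have R: "prob_space R"
    unfolding R_def by (rule prob_space.prob_space_distr[OF J])
  have sets_R: "sets R = sets borel"
    by (simp add: R_def)
  have Q: "prob_space Q"
    unfolding Q_def by (rule prob_space.prob_space_distr[OF P \<phi>])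
  interpret P: prob_space P by (rule P)
  interpret Q: prob_space Q by (rule Q)
  interpret R: prob_space R by (rule R)
  interpret QR: pair_prob_space Q R ..
  interpret PR: pair_prob_space P R ..
  have \<theta>J: "\<theta> \<in> J \<rightarrow>\<^sub>M N \<Otimes>\<^sub>M borel"
    unfolding \<theta>_def measurable_cong_sets[OF sets_J refl] using \<phi> by measurable
  have sets_PR: "sets J = sets (P \<Otimes>\<^sub>M R)"
    by (simp add: sets_J sets_R cong: sets_pair_measure_cong)
  have \<theta>PR: "\<theta> \<in> P \<Otimes>\<^sub>M R \<rightarrow>\<^sub>M N \<Otimes>\<^sub>M borel"
    using \<theta>J by (simp add: measurable_cong_sets[OF sets_PR refl])
  have QR: "Q \<Otimes>\<^sub>M R = distr (P \<Otimes>\<^sub>M R) (N \<Otimes>\<^sub>M borel) \<theta>"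
    unfolding Q_def \<theta>_def by (rule distr_pair_map_fst[OF \<phi> R sets_R])
  have I: "extended_mutual_information b J P borel fst snd = extended_KL_divergence b (P \<Otimes>\<^sub>M R) J"
    unfolding J_def R_def by (rule mutual_information_joint_law[OF P K])
  show "rate_distortion b (distr P N \<phi>) e (D / c)
      \<le> extended_mutual_information b (joint_law P K) P borel fst snd"
  \<comment> \<open>Without domination the rate is infinite and the bound trivial; with it,
    \<open>J'\<close> has the density needed for disintegration.\<close>
  proof (cases "absolutely_continuous (P \<Otimes>\<^sub>M R) J")
    case False
    then show ?thesis
      unfolding J_def[symmetric] I by (simp add: extended_KL_divergence_def)
  next
    case True
    have ac: "absolutely_continuous (Q \<Otimes>\<^sub>M R) J'"
      unfolding QR J'_def by (rule absolutely_continuous_distr[OF True sets_PR \<theta>PR])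
    have "sets J' = sets (Q \<Otimes>\<^sub>M R)"
      unfolding QR J'_def by simp
    from QR.density_RN_deriv[OF ac this]
    have J'_dens: "density (Q \<Otimes>\<^sub>M R) (RN_deriv (Q \<Otimes>\<^sub>M R) J') = J'" .
    \<comment> \<open>The marginal condition of \<open>ex_kernel_of_density\<close>: the source
      component of \<open>J'\<close> is the image under \<open>\<phi>\<close> of that of
      \<open>J\<close>.\<close>
    have "distr J' Q fst = distr J N (\<lambda>z. \<phi> (fst z))"
      unfolding J'_def Q_def using \<theta>J
      by (subst distr_distr) (auto intro!: distr_cong simp: \<theta>_def comp_def case_prod_unfold)
    also have "\<dots> = distr (distr J P fst) N \<phi>"
      using \<phi> by (subst distr_distr) (auto simp: comp_def measurable_cong_sets[OF sets_J refl])
    also have "\<dots> = Q"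
      by (simp add: J_def distr_fst_joint_law[OF P K] Q_def)
    finally have "distr (density (Q \<Otimes>\<^sub>M R) (RN_deriv (Q \<Otimes>\<^sub>M R) J')) Q fst = Q"
      by (simp add: J'_dens)
    from ex_kernel_of_density[OF Q R sets_R borel_measurable_RN_deriv this]
    obtain K' where K': "K' \<in> Q \<rightarrow>\<^sub>M prob_algebra borel" and J': "joint_law Q K' = J'"
      unfolding J'_dens by blast
    have "distr J' borel snd = R"
      unfolding J'_def R_def \<theta>_def by (rule distr_snd_map_prod[OF sets_J \<phi>])
    then have "extended_mutual_information b J' Q borel fst snd = extended_KL_divergence b (Q \<Otimes>\<^sub>M R) J'"
      using mutual_information_joint_law[OF Q K'] by (simp add: J')
    also have "\<dots> \<le> extended_KL_divergence b (P \<Otimes>\<^sub>M R) J"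
      unfolding QR J'_def
      by (rule extended_KL_divergence_distr_le[OF b PR.prob_space_axioms J sets_PR \<theta>PR])
    finally have I_le: "extended_mutual_information b J' Q borel fst snd
        \<le> extended_mutual_information b J P borel fst snd"
      by (simp add: I)
    have space_J: "space J = space P \<times> UNIV"
      using sets_eq_imp_space_eq[OF sets_J] by (simp add: space_pair_measure)
    have bnd: "0 \<le> (case \<theta> z of (x, a) \<Rightarrow> e x a)"
        "(case \<theta> z of (x, a) \<Rightarrow> e x a) \<le> (case z of (t, a) \<Rightarrow> d t a) / c" if "z \<in> space J" for z
      using that e_nn e_le c by (auto simp: space_J \<theta>_def field_simps)
    have intd: "integrable J (\<lambda>z. (case z of (t, a) \<Rightarrow> d t a) / c)"
      using int unfolding J_def by simp
    have inte: "integrable J (\<lambda>z. case \<theta> z of (x, a) \<Rightarrow> e x a)"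
    proof (rule Bochner_Integration.integrable_bound[OF intd])
      show "(\<lambda>z. case \<theta> z of (x, a) \<Rightarrow> e x a) \<in> borel_measurable J"
        by (rule measurable_compose[OF \<theta>J e])
      show "AE z in J. norm (case \<theta> z of (x, a) \<Rightarrow> e x a) \<le> norm ((case z of (t, a) \<Rightarrow> d t a) / c)"
      proof (rule AE_I2)
        fix z assume "z \<in> space J"
        from bnd[OF this] show "norm (case \<theta> z of (x, a) \<Rightarrow> e x a) \<le> norm ((case z of (t, a) \<Rightarrow> d t a) / c)"
          unfolding real_norm_def by linarith
      qed
    qed
    have "(\<integral>z. (case \<theta> z of (x, a) \<Rightarrow> e x a) \<partial>J) \<le> (\<integral>z. (case z of (t, a) \<Rightarrow> d t a) / c \<partial>J)"
      by (intro integral_mono inte intd bnd)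
    also have "\<dots> \<le> D / c"
      using le c by (simp add: J_def divide_right_mono)
    finally have le': "(\<integral>(x, a). e x a \<partial>J') \<le> D / c"
      unfolding J'_def by (subst integral_distr[OF \<theta>J e])
    have inte': "integrable J' (\<lambda>(x, a). e x a)"
      using inte unfolding J'_def by (subst integrable_distr_eq[OF \<theta>J e])
    have "rate_distortion b Q e (D / c) \<le> extended_mutual_information b J' Q borel fst snd"
      unfolding rate_distortion_def using K' inte' le'
      by (intro Inf_lower CollectI exI[of _ K'] conjI) (simp_all add: J')
    with I_le show ?thesis
      by (simp add: Q_def J_def)
  qed
qed

section \<open>Task loss against squared error\<close>

theorem proposition2:
  fixes M :: "'w measure"
    and S :: "(real ^ 'd) set"
    and T :: "'w \<Rightarrow> real ^ 'd"
    and U :: "real ^ 'd \<Rightarrow> real ^ 'r \<Rightarrow> real"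
    and \<phi> :: "real ^ 'd \<Rightarrow> real ^ 'r"
    and \<alpha> \<beta> b :: real
  assumes b: "1 < b"
    and M: "prob_space M"
    and T: "T \<in> M \<rightarrow>\<^sub>M restrict_space borel S"
    and alpha_beta: "0 < \<alpha>" "\<alpha> \<le> \<beta>"
    and U_measurable: "(\<lambda>(t, a). U t a) \<in> borel_measurable (restrict_space borel S \<Otimes>\<^sub>M borel)"
    and \<phi>_measurable: "\<phi> \<in> borel_measurable (restrict_space borel S)"
    and U_twice_differentiable: "\<And>t. t \<in> S \<Longrightarrow> twice_differentiable (U t)"
    and A0: "\<And>t a. t \<in> S \<Longrightarrow> U t a \<le> U t (\<phi> t)"
    and A1: "\<And>t a. t \<in> S \<Longrightarrow> (- \<beta>) *\<^sub>R mat 1 \<preceq>\<^sub>L hessian (U t) a"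
    and A2: "\<And>t a. t \<in> S \<Longrightarrow> hessian (U t) a \<preceq>\<^sub>L (- \<alpha>) *\<^sub>R mat 1"
  shows "(\<forall>D\<ge>0.
            R_MSE b M (\<phi> \<circ> T) (2 * D / \<alpha>) \<le> R_task b M T S U \<phi> D \<and>
            R_task b M T S U \<phi> D \<le> R_MSE b M (\<phi> \<circ> T) (2 * D / \<beta>)) \<and>
         (\<forall>u \<gamma>. \<gamma> > 0 \<longrightarrow>
            (\<forall>t\<in>S. \<forall>a. U t a = u t - \<gamma> / 2 * (norm (a - \<phi> t))\<^sup>2) \<longrightarrow>
            (\<forall>D\<ge>0. R_task b M T S U \<phi> D = R_MSE b M (\<phi> \<circ> T) (2 * D / \<gamma>)))"
proof -
  define P where "P = distr M (restrict_space borel S) T"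
  interpret M: prob_space M by (rule M)
  have P: "prob_space P"
    unfolding P_def by (rule M.prob_space_distr[OF T])
  have space_P: "space P = S"
    by (simp add: P_def space_restrict_space)
  have \<phi>: "\<phi> \<in> P \<rightarrow>\<^sub>M borel"
    using \<phi>_measurable by (simp add: P_def)
  have X: "distr M borel (\<phi> \<circ> T) = distr P borel \<phi>"
    unfolding P_def by (rule distr_distr[OF \<phi>_measurable T, symmetric])
  define e where "e x a = (norm (x - a))\<^sup>2" for x a :: "real ^ 'r"
  have e: "(\<lambda>(x, a). e x a) \<in> borel_measurable (borel \<Otimes>\<^sub>M borel)"
    unfolding e_def by measurable
  have e_nn: "0 \<le> e x a" for x a
    by (simp add: e_def)
  have mse: "R_MSE b M (\<phi> \<circ> T) \<delta> = rate_distortion b (distr P borel \<phi>) e \<delta>" for \<delta>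
    unfolding R_MSE_def X e_def ..
  have task: "R_task b M T S U \<phi> D = rate_distortion b P (task_loss U \<phi>) D" for D
    unfolding R_task_def P_def ..
  have loss: "(\<lambda>(t, a). task_loss U \<phi> t a) \<in> borel_measurable (P \<Otimes>\<^sub>M borel)"
  proof -
    have sets: "sets (P \<Otimes>\<^sub>M borel) = sets (restrict_space borel S \<Otimes>\<^sub>M (borel :: (real ^ 'r) measure))"
      by (simp add: P_def cong: sets_pair_measure_cong)
    note [measurable] = U_measurable \<phi>_measurable
    \<comment> \<open>Written so that \<open>t \<mapsto> U t (\<phi> t)\<close> appears as the
      jointly measurable \<open>U\<close> composed with the measurable graph map of
      \<open>\<phi>\<close>.\<close>
    have "(\<lambda>z. (case (fst z, \<phi> (fst z)) of (t, a) \<Rightarrow> U t a) - (case z of (t, a) \<Rightarrow> U t a))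
        \<in> borel_measurable (restrict_space borel S \<Otimes>\<^sub>M borel)"
      by measurable
    then show ?thesis
      by (simp add: measurable_cong_sets[OF sets refl] task_loss_def case_prod_unfold)
  qed
  have loss_nn: "0 \<le> task_loss U \<phi> t a" if "t \<in> S" for t a
    using A0[OF that] by (simp add: task_loss_def)
  \<comment> \<open>The factor \<open>c / 2\<close> from the quadratic bound turns the distortion
    level \<open>D / (c / 2)\<close> into \<open>2 * D / c\<close>. The constant stays free, to be
    \<open>\<alpha>\<close> or \<open>\<gamma>\<close> here and \<open>\<beta>\<close> or
    \<open>\<gamma>\<close> in \<open>upper\<close>.\<close>
  have lower: "R_MSE b M (\<phi> \<circ> T) (2 * D / c) \<le> R_task b M T S U \<phi> D"
    if "0 < c" "\<And>t a. t \<in> S \<Longrightarrow> c / 2 * e (\<phi> t) a \<le> task_loss U \<phi> t a" for c D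
    using rate_distortion_distr_le_rate_distortion[OF b P \<phi> e, of "c / 2" "task_loss U \<phi>" D] that
    by (simp add: mse task space_P e_nn mult.commute)
  have upper: "R_task b M T S U \<phi> D \<le> R_MSE b M (\<phi> \<circ> T) (2 * D / c)"
    if "0 < c" "\<And>t a. t \<in> S \<Longrightarrow> task_loss U \<phi> t a \<le> c / 2 * e (\<phi> t) a" for c D
    using rate_distortion_le_rate_distortion_distr[OF P \<phi> loss, of "c / 2" e b D] that loss_nn
    by (simp add: mse task space_P mult.commute)
  have bounds: "\<alpha> / 2 * e (\<phi> t) a \<le> task_loss U \<phi> t a"
      "task_loss U \<phi> t a \<le> \<beta> / 2 * e (\<phi> t) a" if t: "t \<in> S" for t a
    using suboptimality_bounds[OF U_twice_differentiable[OF t] A0[OF t] A1[OF t] A2[OF t]]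
    by (simp_all add: e_def task_loss_def)
  show ?thesis
  proof (intro conjI allI impI)
    fix D :: real
    show "R_MSE b M (\<phi> \<circ> T) (2 * D / \<alpha>) \<le> R_task b M T S U \<phi> D"
      using alpha_beta by (intro lower bounds)
    show "R_task b M T S U \<phi> D \<le> R_MSE b M (\<phi> \<circ> T) (2 * D / \<beta>)"
      using alpha_beta by (intro upper bounds) simp_all
  next
    fix u \<gamma> and D :: real
    assume \<gamma>: "\<gamma> > 0" and "\<forall>t\<in>S. \<forall>a. U t a = u t - \<gamma> / 2 * (norm (a - \<phi> t))\<^sup>2"
    \<comment> \<open>The term \<open>u t\<close> cancels in the loss, so both comparisons hold with
      the same constant and the two bounds meet.\<close>
    then have "task_loss U \<phi> t a = \<gamma> / 2 * e (\<phi> t) a" if "t \<in> S" for t a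
      using that by (simp add: task_loss_def e_def norm_minus_commute)
    then show "R_task b M T S U \<phi> D = R_MSE b M (\<phi> \<circ> T) (2 * D / \<gamma>)"
      using lower[OF \<gamma>] upper[OF \<gamma>] by (simp add: antisym)
  qed
qed

end
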